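(* Let $m,n,k$ be positive integers. Let $\mathcal{A}$ be the set of all real $m\times n$ doubly substochastic matrices, i.e. matrices $E=(e_{i,j})$ with $e_{i,j}\ge 0$ for all $i,j$, $\sum_{j=1}^n e_{i,j}\le 1$ for every $i=1,\dots,m$, and $\sum_{i=1}^m e_{i,j}\le 1$ for every $j=1,\dots,n$. Let $\mathcal{A}_k=\{E\in\mathcal{A}: e_{i,j}\in[0,1/k] \text{ for all } i=1,\dots,m,\ j=1,\dots,n\}$, and let $\mathcal{B}_k$ be the set of all matrices in $\mathcal{A}_k$ each of whose entries is either $0$ or $1/k$. Then $\mathcal{A}_k$ is the convex hull of $\mathcal{B}_k$. *)

theory Defs
  imports "HOL-Analysis.Analysis"
begin

(* real ^ 'n ^ 'm: matrices with rows indexed by 'm and columns by 'n, entry E $ i $ j *)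

definition doubly_substochastic :: "(real ^ 'n ^ 'm) set" where
  "doubly_substochastic =
     {E. (\<forall>i j. 0 \<le> E $ i $ j) \<and>
         (\<forall>i. (\<Sum>j\<in>UNIV. E $ i $ j) \<le> 1) \<and>
         (\<forall>j. (\<Sum>i\<in>UNIV. E $ i $ j) \<le> 1)}"

definition substoch_bounded :: "nat \<Rightarrow> (real ^ 'n ^ 'm) set" where
  "substoch_bounded k =
     {E \<in> doubly_substochastic. \<forall>i j. E $ i $ j \<in> {0 .. 1 / real k}}"

definition substoch_two_valued :: "nat \<Rightarrow> (real ^ 'n ^ 'm) set" where
  "substoch_two_valued k =
     {E \<in> substoch_bounded k. \<forall>i j. E $ i $ j = 0 \<or> E $ i $ j = 1 / real k}"

end

theory Submission
  imports Defs
begin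

text \<open>
  By Minkowski's theorem it suffices that every extreme point \<open>E\<close> of the compact convex set
  \<open>\<A>\<^sub>k\<close> has all entries in \<open>{0, 1/k}\<close>. Let \<open>F\<close> be the set of positions of the other entries, and
  let \<open>R\<close>, \<open>C\<close> be the rows and columns that meet \<open>F\<close> and have sum \<open>1\<close>. As \<open>1\<close> is an integral
  multiple of \<open>1/k\<close>, each of them contains at least two positions of \<open>F\<close>, so \<open>2|R| \<le> |F|\<close> and
  \<open>2|C| \<le> |F|\<close>. A direction supported on \<open>F\<close> whose sum vanishes on each line in \<open>R\<close> and \<open>C\<close> keeps
  \<open>E\<close> inside \<open>\<A>\<^sub>k\<close> in both senses; such a nonzero direction exists when \<open>|R| + |C| < |F|\<close>. Otherwise
  \<open>|R| + |C| = |F|\<close> and \<open>F \<subseteq> R \<times> C\<close>. Then the row sums and the column sums have the same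
  total, so one of the equations is redundant and a nonzero direction exists again.
\<close>

text \<open>If \<open>j\<close> were the only such index, every other term would be a multiple of
  \<open>1 / real k\<close>, and so would the total \<open>1\<close>. Hence
  \<open>real k * x j\<close> would be an integer strictly between 0 and 1.\<close>

lemma card_fractional_ge_2:
  fixes x :: "'a::finite \<Rightarrow> real"
  assumes "k > 0" and range: "\<And>j. x j \<in> {0..1 / real k}" and sum1: "(\<Sum>j\<in>UNIV. x j) = 1"
    and j: "x j \<noteq> 0" "x j \<noteq> 1 / real k"
  shows "2 \<le> card {j. x j \<noteq> 0 \<and> x j \<noteq> 1 / real k}" (is "2 \<le> card ?S")
proof (rule ccontr)
  assume "\<not> 2 \<le> card ?S"
  moreover have "j \<in> ?S" using j by simp
  moreover have "card ?S \<noteq> 0" using \<open>j \<in> ?S\<close> by auto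
  ultimately have "card ?S = 1" by linarith
  then obtain a where "?S = {a}" by (rule card_1_singletonE)
  with \<open>j \<in> ?S\<close> have S: "?S = {j}" by simp
  let ?c = "card {i. i \<noteq> j \<and> x i = 1 / real k}"
  have "(\<Sum>i\<in>UNIV - {j}. x i) = (\<Sum>i\<in>{i. i \<noteq> j \<and> x i = 1 / real k}. x i)"
    using S by (intro sum.mono_neutral_right) auto
  also have "\<dots> = real ?c * (1 / real k)"
    by simp
  finally have "1 = x j + real ?c / real k"
    using sum1 by (simp add: sum.remove[of UNIV j])
  then have "real k * x j = real_of_int (int k - int ?c)"
    using \<open>k > 0\<close> by (simp add: field_simps)
  moreover have "0 < x j" "x j < 1 / real k"
    using range[of j] j by simp_all
  then have "0 < real k * x j" "real k * x j < 1"
    using \<open>k > 0\<close> by (simp_all add: field_simps)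
  ultimately show False by (simp only: of_int_0_less_iff of_int_less_1_iff)
qed

text \<open>Count \<open>F\<close> row by row. The bound involves only the part of \<open>F\<close>
  over \<open>R\<close>, so that equality with \<open>card F\<close> later forces all of
  \<open>F\<close> to lie over \<open>R\<close>.\<close>

lemma double_card_le_card_Int_Times:
  assumes "finite F" "finite R" "\<And>i. i \<in> R \<Longrightarrow> 2 \<le> card {j. (i, j) \<in> F}"
  shows "2 * card R \<le> card (F \<inter> R \<times> UNIV)"
proof -
  have fin: "finite {j. (i, j) \<in> F}" for i
    using finite_subset[of "{j. (i, j) \<in> F}" "snd ` F"] \<open>finite F\<close> by force
  have "F \<inter> R \<times> UNIV = (SIGMA i:R. {j. (i, j) \<in> F})" by auto
  then have "card (F \<inter> R \<times> UNIV) = (\<Sum>i\<in>R. card {j. (i, j) \<in> F})"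
    using fin \<open>finite R\<close> by simp
  moreover have "of_nat (card R) * 2 \<le> (\<Sum>i\<in>R. card {j. (i, j) \<in> F})"
    using assms(3) by (intro sum_bounded_below)
  ultimately show ?thesis by simp
qed

text \<open>Each condition on \<open>D\<close> is orthogonality to one fixed matrix, and there are
  fewer conditions than the dimension of the matrix space.\<close>

lemma exists_supported_matrix_zero_sums:
  fixes F :: "('m::finite \<times> 'n::finite) set"
  assumes "card R + card C < card F"
  obtains D :: "real ^ 'n ^ 'm" where "D \<noteq> 0" "\<And>i j. (i, j) \<notin> F \<Longrightarrow> D $ i $ j = 0"
    "\<And>i. i \<in> R \<Longrightarrow> (\<Sum>j\<in>UNIV. D $ i $ j) = 0" "\<And>j. j \<in> C \<Longrightarrow> (\<Sum>i\<in>UNIV. D $ i $ j) = 0"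
proof -
  \<comment> \<open>The inner products of \<open>D\<close> with \<open>r i\<close>,
    \<open>c j\<close> and \<open>u (i, j)\<close> are the sum of row \<open>i\<close>, the sum of
    column \<open>j\<close> and the entry at \<open>(i, j)\<close>.\<close>
  define r :: "'m \<Rightarrow> real ^ 'n ^ 'm" where "r i = axis i (\<chi> j. 1)" for i
  define c :: "'n \<Rightarrow> real ^ 'n ^ 'm" where "c j = (\<chi> i. axis j 1)" for j
  define u :: "'m \<times> 'n \<Rightarrow> real ^ 'n ^ 'm" where "u p = axis (fst p) (axis (snd p) 1)" for p
  let ?W = "r ` R \<union> c ` C \<union> u ` (- F)"
  have "card F \<le> CARD('m \<times> 'n)" by (rule card_mono) auto
  have "dim ?W \<le> card ?W" by (rule dim_le_card') simp
  also have "\<dots> \<le> card (r ` R) + card (c ` C) + card (u ` (- F))"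
    by (meson add_mono card_Un_le le_trans order_refl)
  also have "\<dots> \<le> card R + card C + card (- F)"
    by (intro add_mono card_image_le) auto
  also have "\<dots> < DIM(real ^ 'n ^ 'm)"
    using assms \<open>card F \<le> _\<close> by (simp add: Compl_eq_Diff_UNIV card_Diff_subset)
  finally obtain D where D: "D \<noteq> 0" "\<And>y. y \<in> span ?W \<Longrightarrow> orthogonal D y"
    using orthogonal_to_subspace_exists by blast
  have orth: "D \<bullet> w = 0" if "w \<in> ?W" for w
    using D(2) that by (simp add: span_base orthogonal_def)
  show thesis
  proof (rule that[OF D(1)])
    show "D $ i $ j = 0" if "(i, j) \<notin> F" for i j
      using orth[of "u (i, j)", OF UnI2[OF imageI]] that by (simp add: u_def inner_axis)
    show "(\<Sum>j\<in>UNIV. D $ i $ j) = 0" if "i \<in> R" for i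
      using orth[of "r i", OF UnI1[OF UnI1[OF imageI]]] that
      by (simp add: r_def inner_axis) (simp add: inner_vec_def)
    show "(\<Sum>i\<in>UNIV. D $ i $ j) = 0" if "j \<in> C" for j
      using orth[of "c j", OF UnI1[OF UnI2[OF imageI]]] that
      by (simp add: c_def inner_vec_def[of D] inner_axis)
  qed
qed

lemma substoch_bounded_iff:
  "E \<in> substoch_bounded k \<longleftrightarrow> (\<forall>i j. 0 \<le> E $ i $ j \<and> E $ i $ j \<le> 1 / real k) \<and>
     (\<forall>i. (\<Sum>j\<in>UNIV. E $ i $ j) \<le> 1) \<and> (\<forall>j. (\<Sum>i\<in>UNIV. E $ i $ j) \<le> 1)"
  by (auto simp: substoch_bounded_def doubly_substochastic_def)

lemma convex_substoch_bounded: "convex (substoch_bounded k)"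
proof (rule convexI)
  fix x y :: "real ^ 'n ^ 'm" and u v :: real
  assume x: "x \<in> substoch_bounded k" and y: "y \<in> substoch_bounded k"
    and uv: "0 \<le> u" "0 \<le> v" "u + v = 1"
  show "u *\<^sub>R x + v *\<^sub>R y \<in> substoch_bounded k"
    using x y uv unfolding substoch_bounded_iff
    by (auto simp: sum.distrib sum_distrib_left[symmetric] intro!: convex_bound_le)
qed

lemma compact_substoch_bounded: "compact (substoch_bounded k :: (real ^ 'n ^ 'm) set)"
proof -
  have set_eq_Collect: "substoch_bounded k = {E :: real ^ 'n ^ 'm.
      (\<forall>i j. 0 \<le> E $ i $ j \<and> E $ i $ j \<le> 1 / real k) \<and>
      (\<forall>i. (\<Sum>j\<in>UNIV. E $ i $ j) \<le> 1) \<and> (\<forall>j. (\<Sum>i\<in>UNIV. E $ i $ j) \<le> 1)}"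
    using substoch_bounded_iff by blast
  have "norm E \<le> (\<Sum>i\<in>(UNIV::'m set). \<Sum>j\<in>(UNIV::'n set). 1 / real k)"
    if "E \<in> substoch_bounded k" for E :: "real ^ 'n ^ 'm"
  proof -
    have "norm E \<le> (\<Sum>i\<in>UNIV. norm (E $ i))"
      by (simp add: norm_vec_def L2_set_le_sum)
    also have "\<dots> \<le> (\<Sum>i\<in>UNIV. \<Sum>j\<in>UNIV. \<bar>E $ i $ j\<bar>)"
      by (intro sum_mono norm_le_l1_cart)
    also have "\<dots> \<le> (\<Sum>i\<in>(UNIV::'m set). \<Sum>j\<in>(UNIV::'n set). 1 / real k)"
      using that by (intro sum_mono) (simp add: substoch_bounded_iff)
    finally show ?thesis .
  qed
  then have "bounded (substoch_bounded k :: (real ^ 'n ^ 'm) set)"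
    unfolding bounded_iff by blast
  moreover have "closed (substoch_bounded k :: (real ^ 'n ^ 'm) set)"
    unfolding set_eq_Collect
    by (intro closed_Collect_conj closed_Collect_all closed_Collect_le continuous_intros)
  ultimately show ?thesis by (simp add: compact_eq_bounded_closed)
qed

text \<open>A strict inequality survives small \<open>t\<close> by continuity; a tight one does not
  change, as \<open>d = 0\<close>. Since \<open>nhds 0\<close> is two-sided, both signs of
  \<open>t\<close> are covered.\<close>

lemma eventually_perturbation_le:
  fixes a b d :: real
  assumes "a \<le> b" "a = b \<Longrightarrow> d = 0"
  shows "\<forall>\<^sub>F t in nhds 0. a + t * d \<le> b"
proof (cases "a = b")
  case False
  have "((\<lambda>t. a + t * d) \<longlongrightarrow> a + 0 * d) (nhds 0)"
    by (intro tendsto_intros filterlim_ident)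
  then have "\<forall>\<^sub>F t in nhds 0. a + t * d < b"
    using False assms(1) by (intro order_tendstoD(2)) auto
  then show ?thesis by (rule eventually_mono) simp
qed (use assms in simp)

lemma extreme_point_substoch_bounded_two_valued:
  fixes E :: "real ^ 'n::finite ^ 'm::finite"
  assumes "k > 0" and ext: "E extreme_point_of substoch_bounded k"
  shows "E \<in> substoch_two_valued k"
proof (rule ccontr)
  assume not_two_valued: "E \<notin> substoch_two_valued k"
  have E: "E \<in> substoch_bounded k" using ext by (simp add: extreme_point_of_def)
  define F where "F = {(i, j). E $ i $ j \<noteq> 0 \<and> E $ i $ j \<noteq> 1 / real k}"
  have "F \<noteq> {}" using not_two_valued E by (auto simp: substoch_two_valued_def F_def)
  define R where "R = {i. (\<Sum>j\<in>UNIV. E $ i $ j) = 1 \<and> (\<exists>j. (i, j) \<in> F)}"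
  define C where "C = {j. (\<Sum>i\<in>UNIV. E $ i $ j) = 1 \<and> (\<exists>i. (i, j) \<in> F)}"
  have "2 \<le> card {j. (i, j) \<in> F}" if "i \<in> R" for i
    using that E card_fractional_ge_2[OF \<open>k > 0\<close>, of "\<lambda>j. E $ i $ j"]
    by (auto simp: R_def F_def substoch_bounded_iff)
  then have R2: "2 * card R \<le> card (F \<inter> R \<times> UNIV)"
    by (intro double_card_le_card_Int_Times) auto
  \<comment> \<open>Columns of \<open>F\<close> are counted as rows of its converse.\<close>
  have "2 \<le> card {i. (j, i) \<in> F\<inverse>}" if "j \<in> C" for j
    using that E card_fractional_ge_2[OF \<open>k > 0\<close>, of "\<lambda>i. E $ i $ j"]
    by (auto simp: C_def F_def substoch_bounded_iff)
  then have "2 * card C \<le> card (F\<inverse> \<inter> C \<times> UNIV)"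
    by (intro double_card_le_card_Int_Times) auto
  also have "F\<inverse> \<inter> C \<times> UNIV = (F \<inter> UNIV \<times> C)\<inverse>" by auto
  finally have C2: "2 * card C \<le> card (F \<inter> UNIV \<times> C)" by simp
  have le: "card (F \<inter> R \<times> UNIV) \<le> card F" "card (F \<inter> UNIV \<times> C) \<le> card F"
    by (auto intro: card_mono)

  obtain D :: "real ^ 'n ^ 'm" where "D \<noteq> 0"
    and supp: "\<And>i j. (i, j) \<notin> F \<Longrightarrow> D $ i $ j = 0"
    and rows: "\<And>i. i \<in> R \<Longrightarrow> (\<Sum>j\<in>UNIV. D $ i $ j) = 0"
    and cols: "\<And>j. j \<in> C \<Longrightarrow> (\<Sum>i\<in>UNIV. D $ i $ j) = 0"
  proof (cases "card R + card C < card F")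
    case True
    then show thesis using that by (rule exists_supported_matrix_zero_sums)
  next
    case False
    \<comment> \<open>Here \<open>2 * card R\<close> and \<open>2 * card C\<close> are each at most
      \<open>card F\<close>, while their sum is at least twice \<open>card F\<close>, so every
      estimate is an equality.\<close>
    then have "card (F \<inter> R \<times> UNIV) = card F" "card (F \<inter> UNIV \<times> C) = card F"
      using R2 C2 le by linarith+
    then have "F \<inter> R \<times> UNIV = F" "F \<inter> UNIV \<times> C = F"
      by (simp_all add: card_subset_eq)
    then have FR: "\<And>i j. (i, j) \<in> F \<Longrightarrow> i \<in> R" and FC: "\<And>i j. (i, j) \<in> F \<Longrightarrow> j \<in> C"
      by blast+
    obtain i0 where "i0 \<in> R" using \<open>F \<noteq> {}\<close> FR by fastforce
    then have "0 < card R" by (auto simp: card_gt_0_iff)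
    \<comment> \<open>The equation of row \<open>i0\<close> is dropped to make the count strict; it
      is recovered below from the total sum of \<open>D\<close>.\<close>
    then have "card (R - {i0}) + card C < card F"
      using R2 C2 le \<open>i0 \<in> R\<close> by simp
    then obtain D :: "real ^ 'n ^ 'm" where D: "D \<noteq> 0"
      "\<And>i j. (i, j) \<notin> F \<Longrightarrow> D $ i $ j = 0"
      "\<And>i. i \<in> R - {i0} \<Longrightarrow> (\<Sum>j\<in>UNIV. D $ i $ j) = 0"
      "\<And>j. j \<in> C \<Longrightarrow> (\<Sum>i\<in>UNIV. D $ i $ j) = 0"
      using exists_supported_matrix_zero_sums by blast
    \<comment> \<open>Columns outside \<open>C\<close> contain no position of \<open>F\<close>, so
      \<open>D\<close> vanishes on them.\<close>
    have "(\<Sum>i\<in>UNIV. D $ i $ j) = 0" for j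
      by (cases "j \<in> C") (blast intro: D(2,4) sum.neutral dest: FC)+
    then have "0 = (\<Sum>j\<in>UNIV. \<Sum>i\<in>UNIV. D $ i $ j)" by simp
    also have "\<dots> = (\<Sum>i\<in>UNIV. \<Sum>j\<in>UNIV. D $ i $ j)" by (rule sum.swap)
    also have "\<dots> = (\<Sum>i\<in>{i0}. \<Sum>j\<in>UNIV. D $ i $ j)"
    proof (intro sum.mono_neutral_right ballI)
      fix i assume "i \<in> UNIV - {i0}"
      then show "(\<Sum>j\<in>UNIV. D $ i $ j) = 0"
        by (cases "i \<in> R") (blast intro: D(2,3) sum.neutral dest: FR)+
    qed auto
    finally have "(\<Sum>j\<in>UNIV. D $ i $ j) = 0" if "i \<in> R" for i
      using D(3) that by (cases "i = i0") auto
    then show thesis using that D by blast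
  qed

  have "\<forall>\<^sub>F t in nhds 0. - (E $ i $ j) + t * - (D $ i $ j) \<le> 0" for i j
    using E supp by (intro eventually_perturbation_le) (auto simp: substoch_bounded_iff F_def)
  moreover have "\<forall>\<^sub>F t in nhds 0. E $ i $ j + t * D $ i $ j \<le> 1 / real k" for i j
    using E supp by (intro eventually_perturbation_le) (auto simp: substoch_bounded_iff F_def)
  \<comment> \<open>A row of sum 1 is either in \<open>R\<close> or disjoint from \<open>F\<close>;
    in both cases the corresponding row sum of \<open>D\<close> is 0.\<close>
  moreover have "\<forall>\<^sub>F t in nhds 0. (\<Sum>j\<in>UNIV. E $ i $ j) + t * (\<Sum>j\<in>UNIV. D $ i $ j) \<le> 1" for i
  proof (rule eventually_perturbation_le)
    show "(\<Sum>j\<in>UNIV. D $ i $ j) = 0" if "(\<Sum>j\<in>UNIV. E $ i $ j) = 1"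
      using that supp rows by (cases "i \<in> R") (auto simp: R_def intro!: sum.neutral)
  qed (use E in \<open>simp add: substoch_bounded_iff\<close>)
  moreover have "\<forall>\<^sub>F t in nhds 0. (\<Sum>i\<in>UNIV. E $ i $ j) + t * (\<Sum>i\<in>UNIV. D $ i $ j) \<le> 1" for j
  proof (rule eventually_perturbation_le)
    show "(\<Sum>i\<in>UNIV. D $ i $ j) = 0" if "(\<Sum>i\<in>UNIV. E $ i $ j) = 1"
      using that supp cols by (cases "j \<in> C") (auto simp: C_def intro!: sum.neutral)
  qed (use E in \<open>simp add: substoch_bounded_iff\<close>)
  ultimately have "\<forall>\<^sub>F t in nhds 0.
      (\<forall>i j. - (E $ i $ j) + t * - (D $ i $ j) \<le> 0) \<and>
      (\<forall>i j. E $ i $ j + t * D $ i $ j \<le> 1 / real k) \<and>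
      (\<forall>i. (\<Sum>j\<in>UNIV. E $ i $ j) + t * (\<Sum>j\<in>UNIV. D $ i $ j) \<le> 1) \<and>
      (\<forall>j. (\<Sum>i\<in>UNIV. E $ i $ j) + t * (\<Sum>i\<in>UNIV. D $ i $ j) \<le> 1)"
    by (intro eventually_conj eventually_all_finite)
  then have "\<forall>\<^sub>F t in nhds 0. E + t *\<^sub>R D \<in> substoch_bounded k"
    by (rule eventually_mono)
      (auto simp: substoch_bounded_iff sum.distrib sum_distrib_left[symmetric] real_0_le_add_iff)
  then obtain d where "d > 0" and d: "\<And>t. dist t 0 < d \<Longrightarrow> E + t *\<^sub>R D \<in> substoch_bounded k"
    unfolding eventually_nhds_metric by blast
  \<comment> \<open>Both parameters lie within distance \<open>d\<close> of 0, and \<open>E\<close>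
    is the midpoint of two distinct points of the set, against extremality.\<close>
  let ?a = "E + (- (d / 2)) *\<^sub>R D" and ?b = "E + (d / 2) *\<^sub>R D"
  have "?a \<in> substoch_bounded k" "?b \<in> substoch_bounded k"
    using \<open>d > 0\<close> by (auto intro!: d simp del: scaleR_minus_left)
  moreover have "E \<in> open_segment ?a ?b"
  proof -
    have "E = midpoint ?a ?b" by (simp add: midpoint_def algebra_simps flip: scaleR_2)
    moreover have "?a \<noteq> ?b" using \<open>d > 0\<close> \<open>D \<noteq> 0\<close> by (simp flip: scaleR_minus_left)
    ultimately show ?thesis by (metis midpoint_in_open_segment)
  qed
  ultimately show False using ext by (auto simp: extreme_point_of_def)
qed

theorem theorem1:
  fixes k :: nat
  assumes "k > 0"
  shows "(substoch_bounded k :: (real ^ 'n::finite ^ 'm::finite) set) = convex hull (substoch_two_valued k)"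
proof
  have "(substoch_bounded k :: (real ^ 'n ^ 'm) set)
      = convex hull {E. E extreme_point_of substoch_bounded k}"
    by (rule Krein_Milman_Minkowski[OF compact_substoch_bounded convex_substoch_bounded])
  also have "\<dots> \<subseteq> convex hull (substoch_two_valued k)"
    using extreme_point_substoch_bounded_two_valued[OF assms] by (intro hull_mono) blast
  finally show "(substoch_bounded k :: (real ^ 'n ^ 'm) set) \<subseteq> convex hull (substoch_two_valued k)" .
  show "convex hull (substoch_two_valued k) \<subseteq> (substoch_bounded k :: (real ^ 'n ^ 'm) set)"
    by (intro hull_minimal convex_substoch_bounded) (auto simp: substoch_two_valued_def)
qed

end
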